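(* Let $b$ be a connected graph over $(X,m)$ with $\mathcal{L}(C_c(X))\subseteq \ell^2(X,m)$ and let $L_c$ be the restriction of the formal Laplacian $\mathcal{L}$ to $C_c(X)$. (1) If $L_c$ is essentially self-adjoint, then $L_c$ satisfies the $\ell^2$-Liouville property, i.e., all harmonic functions in $\ell^2(X,m)$ are constant. (2) If $L_c$ satisfies the $\ell^2$-Liouville property, $L_c$ is strictly positive and $m(X)=\infty$, then $L_c$ is essentially self-adjoint.
   Context: Graphs. $X$ is a countably infinite set, $m:X\to(0,\infty)$ is extended to subsets of $X$ by additivity, and a graph over $(X,m)$ is a function $b:X\times X\to[0,\infty)$ with $b(x,x)=0$, $b(x,y)=b(y,x)$ and $\sum_{y\in X}b(x,y)<\infty$ for all $x,y\in X$ (vertices may have infinitely many neighbors). Write $x\sim y$ if $b(x,y)>0$. The graph is connected if any two vertices $x,y$ are joined by a finite sequence $x=x_0\sim x_1\sim\dots\sim x_n=y$. $C(X)$ is the set of all functions $X\to\mathbb{R}$, $C_c(X)$ the finitely supported ones, and $\ell^2(X,m)=\{f\in C(X): \sum_x f^2(x)m(x)<\infty\}$ with inner product $\langle f,g\rangle=\sum_x f(x)g(x)m(x)$. Let $\mathcal{F}=\{f\in C(X): \sum_{y}b(x,y)|f(y)|<\infty \text{ for all } x\in X\}$. The formal Laplacian is $\mathcal{L}f(x)=\frac{1}{m(x)}\sum_{y\in X}b(x,y)(f(x)-f(y))$ for $f\in\mathcal{F}$, $x\in X$. A function $f\in\mathcal{F}$ is harmonic if $\mathcal{L}f=0$ on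 $X$. $L_c$ is the symmetric operator on $\ell^2(X,m)$ with $D(L_c)=C_c(X)$ and $L_cf=\mathcal{L}f$. It is essentially self-adjoint if its closure is self-adjoint (equivalently, it has a unique self-adjoint extension), and strictly positive if there is $C>0$ with $\langle L_cf,f\rangle\ge C\|f\|^2$ for all $f\in C_c(X)$. $L_c$ satisfies the $\ell^2$-Liouville property if every $f\in\ker L_c^*$ is constant; equivalently, every harmonic function $f\in\mathcal{F}\cap\ell^2(X,m)$ is constant. *)

theory Defs
  imports "HOL-Analysis.Analysis"
begin

section \<open>Weighted graphs and the formal Laplacian\<close>

text \<open>The vertex set \<open>X\<close> is the universe of the type \<open>'a\<close>, and \<open>C(X)\<close> is the type \<open>'a \<Rightarrow> real\<close>.\<close>

locale weighted_graph =
  fixes m :: "'a \<Rightarrow> real" and b :: "'a \<Rightarrow> 'a \<Rightarrow> real"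
  assumes countable_vertices: "countable (UNIV :: 'a set)"
    and infinite_vertices: "infinite (UNIV :: 'a set)"
    and measure_pos: "\<And>x. m x > 0"
    and weight_nonneg: "\<And>x y. b x y \<ge> 0"
    and weight_diag: "\<And>x. b x x = 0"
    and weight_sym: "\<And>x y. b x y = b y x"
    and weight_summable: "\<And>x. (\<lambda>y. b x y) summable_on UNIV"

definition vertex_measure :: "('a \<Rightarrow> real) \<Rightarrow> 'a set \<Rightarrow> ennreal" where
  "vertex_measure m A = (\<Sum>\<^sub>\<infinity>x\<in>A. ennreal (m x))"

definition adjacent :: "('a \<Rightarrow> 'a \<Rightarrow> real) \<Rightarrow> 'a \<Rightarrow> 'a \<Rightarrow> bool" where
  "adjacent b x y \<longleftrightarrow> b x y > 0"

definition connected_graph :: "('a \<Rightarrow> 'a \<Rightarrow> real) \<Rightarrow> bool" where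
  "connected_graph b \<longleftrightarrow> (\<forall>x y. (adjacent b)\<^sup>*\<^sup>* x y)"

definition finitely_supported :: "('a \<Rightarrow> real) set" where
  "finitely_supported = {f. finite {x. f x \<noteq> 0}}"

definition laplacian_domain :: "('a \<Rightarrow> 'a \<Rightarrow> real) \<Rightarrow> ('a \<Rightarrow> real) set" where
  "laplacian_domain b = {f. \<forall>x. (\<lambda>y. b x y * \<bar>f y\<bar>) summable_on UNIV}"

text \<open>Only meaningful for functions in \<^term>\<open>laplacian_domain b\<close>, where the series converges
  absolutely; elsewhere \<^const>\<open>infsum\<close> may take its default value 0.\<close>

definition laplacian :: "('a \<Rightarrow> real) \<Rightarrow> ('a \<Rightarrow> 'a \<Rightarrow> real) \<Rightarrow> ('a \<Rightarrow> real) \<Rightarrow> 'a \<Rightarrow> real" where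
  "laplacian m b f x = (1 / m x) * (\<Sum>\<^sub>\<infinity>y. b x y * (f x - f y))"

definition harmonic :: "('a \<Rightarrow> real) \<Rightarrow> ('a \<Rightarrow> 'a \<Rightarrow> real) \<Rightarrow> ('a \<Rightarrow> real) \<Rightarrow> bool" where
  "harmonic m b f \<longleftrightarrow> f \<in> laplacian_domain b \<and> (\<forall>x. laplacian m b f x = 0)"


section \<open>The weighted sequence space\<close>

text \<open>Since \<open>m\<close> is strictly positive, elements of the Hilbert space are genuine functions; no
  quotient by null functions is needed.\<close>

definition l2 :: "('a \<Rightarrow> real) \<Rightarrow> ('a \<Rightarrow> real) set" where
  "l2 m = {f. (\<lambda>x. (f x)\<^sup>2 * m x) summable_on UNIV}"

definition l2_inner :: "('a \<Rightarrow> real) \<Rightarrow> ('a \<Rightarrow> real) \<Rightarrow> ('a \<Rightarrow> real) \<Rightarrow> real" where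
  "l2_inner m f g = (\<Sum>\<^sub>\<infinity>x. f x * g x * m x)"

definition l2_norm :: "('a \<Rightarrow> real) \<Rightarrow> ('a \<Rightarrow> real) \<Rightarrow> real" where
  "l2_norm m f = sqrt (l2_inner m f f)"

definition l2_tendsto :: "('a \<Rightarrow> real) \<Rightarrow> (nat \<Rightarrow> 'a \<Rightarrow> real) \<Rightarrow> ('a \<Rightarrow> real) \<Rightarrow> bool" where
  "l2_tendsto m F f \<longleftrightarrow> (\<lambda>n. l2_norm m (\<lambda>x. F n x - f x)) \<longlonglongrightarrow> 0"


section \<open>Unbounded operators\<close>

text \<open>An operator on the Hilbert space is identified with its graph, a set of pairs
  \<open>(f, T f)\<close> with \<open>f\<close> in the domain; thus the domain is \<^term>\<open>Domain T\<close>.\<close>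

type_synonym 'a l2_op = "(('a \<Rightarrow> real) \<times> ('a \<Rightarrow> real)) set"

definition densely_defined :: "('a \<Rightarrow> real) \<Rightarrow> 'a l2_op \<Rightarrow> bool" where
  "densely_defined m T \<longleftrightarrow>
     (\<forall>f\<in>l2 m. \<exists>F. (\<forall>n. F n \<in> Domain T) \<and> l2_tendsto m F f)"

definition op_closure :: "('a \<Rightarrow> real) \<Rightarrow> 'a l2_op \<Rightarrow> 'a l2_op" where
  "op_closure m T = {(f, g). f \<in> l2 m \<and> g \<in> l2 m \<and>
     (\<exists>F G. (\<forall>n. (F n, G n) \<in> T) \<and> l2_tendsto m F f \<and> l2_tendsto m G g)}"

definition op_adjoint :: "('a \<Rightarrow> real) \<Rightarrow> 'a l2_op \<Rightarrow> 'a l2_op" where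
  "op_adjoint m T = {(g, h). g \<in> l2 m \<and> h \<in> l2 m \<and>
     (\<forall>(f, k)\<in>T. l2_inner m k g = l2_inner m f h)}"

definition op_kernel :: "'a l2_op \<Rightarrow> ('a \<Rightarrow> real) set" where
  "op_kernel T = {f. (f, \<lambda>x. 0) \<in> T}"

text \<open>Equality with the adjoint already forces \<open>T\<close> to be a linear subspace of
  \<open>l2 m \<times> l2 m\<close>, and density of the domain forces the adjoint to be single-valued.\<close>

definition self_adjoint :: "('a \<Rightarrow> real) \<Rightarrow> 'a l2_op \<Rightarrow> bool" where
  "self_adjoint m T \<longleftrightarrow> densely_defined m T \<and> op_adjoint m T = T"

definition essentially_self_adjoint :: "('a \<Rightarrow> real) \<Rightarrow> 'a l2_op \<Rightarrow> bool" where
  "essentially_self_adjoint m T \<longleftrightarrow> self_adjoint m (op_closure m T)"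

definition strictly_positive :: "('a \<Rightarrow> real) \<Rightarrow> 'a l2_op \<Rightarrow> bool" where
  "strictly_positive m T \<longleftrightarrow>
     (\<exists>C>0. \<forall>(f, g)\<in>T. l2_inner m g f \<ge> C * (l2_norm m f)\<^sup>2)"

definition l2_Liouville :: "('a \<Rightarrow> real) \<Rightarrow> 'a l2_op \<Rightarrow> bool" where
  "l2_Liouville m T \<longleftrightarrow> (\<forall>f\<in>op_kernel (op_adjoint m T). f constant_on UNIV)"

definition L_c :: "('a \<Rightarrow> real) \<Rightarrow> ('a \<Rightarrow> 'a \<Rightarrow> real) \<Rightarrow> 'a l2_op" where
  "L_c m b = {(f, laplacian m b f) | f. f \<in> finitely_supported}"

end

theory Submission
  imports Defs
begin

text \<open>(1) If the closure of \<open>L_c\<close> equals its adjoint, a function \<open>f\<close> in the kernel of the adjoint is a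
  limit of finitely supported \<open>F n\<close> with \<open>L F n \<rightarrow> 0\<close>. Since \<open>b x y * (F n x - F n y)\<^sup>2\<close> is at most
  \<open>2 * \<langle>L F n, F n\<rangle>\<close>, the limit takes equal values at adjacent vertices.

  (2) As \<open>m X = \<infinity>\<close>, the only constant in \<open>l2\<close> is zero, so the Liouville property says that
  the adjoint is injective. For a strictly positive symmetric operator this is equivalent to
  essential self-adjointness.\<close>

section \<open>The Hilbert space of a positive weight\<close>

text \<open>First-order condition at a minimum: the polynomial attains its minimum at
  \<open>t = 0\<close>, so its derivative \<open>2 * p\<close> there vanishes. The proof inserts the
  vertex \<open>- p / q\<close>, or \<open>- p\<close> when \<open>q = 0\<close>. It later turns
  minimality of a distance into orthogonality.\<close>

lemma quadratic_nonneg_imp_linear_zero: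
  fixes p q :: real
  assumes "\<And>t. 0 \<le> 2 * t * p + t\<^sup>2 * q" and "0 \<le> q"
  shows "p = 0"
proof (cases "q = 0")
  case True
  show ?thesis using assms(1)[of "-p"] True
    by (simp add: power2_eq_square[symmetric] mult.assoc)
next
  case False
  then have "q > 0" using assms(2) by simp
  have "2 * (- p / q) * p + (- p / q)\<^sup>2 * q = - (p\<^sup>2 / q)"
    using \<open>q > 0\<close> by (simp add: field_simps power2_eq_square)
  then have "p\<^sup>2 / q \<le> 0" using assms(1)[of "- p / q"] by linarith
  then show ?thesis using \<open>q > 0\<close> by (simp add: divide_le_0_iff)
qed

text \<open>The Hilbert space and operator theory needs no edges, only a positive weight;
  \<open>weighted_graph\<close> inherits it as a sublocale.\<close>

locale positive_weight =
  fixes m :: "'a \<Rightarrow> real"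
  assumes weight_pos: "\<And>x. m x > 0"
begin

section \<open>The vector space of square-summable functions\<close>

lemma l2_inner_summable:
  assumes "f \<in> l2 m" "g \<in> l2 m"
  shows "(\<lambda>x. f x * g x * m x) summable_on UNIV"
proof -
  have "(\<lambda>x. (f x)\<^sup>2 * m x + (g x)\<^sup>2 * m x) summable_on UNIV"
    using assms by (intro summable_on_add) (auto simp: l2_def)
  \<comment> \<open>The arithmetic-geometric mean inequality gives an integrable majorant; the
    factor 1/2 is given away.\<close>
  moreover have "norm (f x * g x * m x) \<le> (f x)\<^sup>2 * m x + (g x)\<^sup>2 * m x" for x
  proof -
    have "2 * (\<bar>f x\<bar> * \<bar>g x\<bar>) \<le> (f x)\<^sup>2 + (g x)\<^sup>2"
      using sum_squares_bound[of "\<bar>f x\<bar>" "\<bar>g x\<bar>"] by simp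
    then have "\<bar>f x\<bar> * \<bar>g x\<bar> \<le> (f x)\<^sup>2 + (g x)\<^sup>2"
      using mult_nonneg_nonneg[OF abs_ge_zero abs_ge_zero, of "f x" "g x"] by linarith
    then have "(\<bar>f x\<bar> * \<bar>g x\<bar>) * m x \<le> ((f x)\<^sup>2 + (g x)\<^sup>2) * m x"
      by (rule mult_right_mono) (simp add: less_imp_le weight_pos)
    then show ?thesis
      using weight_pos[of x] by (simp add: abs_mult algebra_simps)
  qed
  ultimately have "(\<lambda>x. norm (f x * g x * m x)) summable_on UNIV"
    by (intro Infinite_Sum.abs_summable_on_comparison_test'[where g = "\<lambda>x. (f x)\<^sup>2 * m x + (g x)\<^sup>2 * m x"]) auto
  then show ?thesis
    by (rule Infinite_Sum.abs_summable_summable)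
qed

lemma l2_add [intro]:
  assumes "f \<in> l2 m" "g \<in> l2 m"
  shows "(\<lambda>x. f x + g x) \<in> l2 m"
proof -
  have "(\<lambda>x. (f x)\<^sup>2 * m x + 2 * (f x * g x * m x) + (g x)\<^sup>2 * m x) summable_on UNIV"
    using assms
    by (intro summable_on_add summable_on_cmult_right l2_inner_summable) (auto simp: l2_def)
  then show ?thesis
    unfolding l2_def by (simp add: power2_eq_square algebra_simps)
qed

lemma l2_scale [intro]:
  assumes "f \<in> l2 m"
  shows "(\<lambda>x. c * f x) \<in> l2 m"
proof -
  have "(\<lambda>x. c\<^sup>2 * ((f x)\<^sup>2 * m x)) summable_on UNIV"
    using assms by (intro summable_on_cmult_right) (auto simp: l2_def)
  then show ?thesis
    by (simp add: l2_def power_mult_distrib mult.assoc)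
qed

lemma l2_diff [intro]:
  assumes "f \<in> l2 m" "g \<in> l2 m"
  shows "(\<lambda>x. f x - g x) \<in> l2 m"
  using l2_add[OF assms(1) l2_scale[OF assms(2), of "-1"]] by simp

lemma l2_zero [simp]: "(\<lambda>x. 0) \<in> l2 m"
  by (simp add: l2_def)

lemma finitely_supported_l2:
  assumes "f \<in> finitely_supported"
  shows "f \<in> l2 m"
  using assms unfolding l2_def finitely_supported_def
  by (auto intro!: has_sum_imp_summable[OF has_sum_finite_neutralI[of "{x. f x \<noteq> 0}"]])

section \<open>Inner product, norm and the Cauchy-Schwarz inequality\<close>

lemma l2_inner_commute: "l2_inner m f g = l2_inner m g f"
  by (simp add: l2_inner_def mult.commute)

lemma l2_inner_add_left:
  assumes "f \<in> l2 m" "g \<in> l2 m" "h \<in> l2 m"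
  shows "l2_inner m (\<lambda>x. f x + g x) h = l2_inner m f h + l2_inner m g h"
  using infsum_add[OF l2_inner_summable[OF assms(1,3)] l2_inner_summable[OF assms(2,3)]]
  by (simp add: l2_inner_def algebra_simps)

lemma l2_inner_scale_left: "l2_inner m (\<lambda>x. c * f x) h = c * l2_inner m f h"
  by (simp add: l2_inner_def mult.assoc infsum_cmult_right')

lemma l2_inner_diff_left:
  assumes "f \<in> l2 m" "g \<in> l2 m" "h \<in> l2 m"
  shows "l2_inner m (\<lambda>x. f x - g x) h = l2_inner m f h - l2_inner m g h"
  using l2_inner_add_left[OF assms(1) l2_scale[OF assms(2), of "-1"] assms(3)]
    l2_inner_scale_left[of "-1" g h] by simp

lemma l2_inner_add_right:
  assumes "f \<in> l2 m" "g \<in> l2 m" "h \<in> l2 m"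
  shows "l2_inner m h (\<lambda>x. f x + g x) = l2_inner m h f + l2_inner m h g"
  using l2_inner_add_left[OF assms] by (simp add: l2_inner_commute)

lemma l2_inner_diff_right:
  assumes "f \<in> l2 m" "g \<in> l2 m" "h \<in> l2 m"
  shows "l2_inner m h (\<lambda>x. f x - g x) = l2_inner m h f - l2_inner m h g"
  using l2_inner_diff_left[OF assms] by (simp add: l2_inner_commute)

lemma l2_inner_scale_right: "l2_inner m h (\<lambda>x. c * f x) = c * l2_inner m h f"
  using l2_inner_scale_left[of c f h] by (simp add: l2_inner_commute)

lemma l2_inner_zero_right [simp]: "l2_inner m h (\<lambda>x. 0) = 0"
  by (simp add: l2_inner_def)

lemma l2_inner_self_nonneg [simp]: "0 \<le> l2_inner m f f"
  unfolding l2_inner_def using weight_pos by (intro infsum_nonneg) (simp add: less_imp_le)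

lemma l2_norm_nonneg [simp]: "0 \<le> l2_norm m f"
  by (simp add: l2_norm_def)

lemma l2_norm_power2: "(l2_norm m f)\<^sup>2 = l2_inner m f f"
  by (simp add: l2_norm_def)

lemma l2_norm_power2_add:
  assumes "f \<in> l2 m" "g \<in> l2 m"
  shows "(l2_norm m (\<lambda>x. f x + g x))\<^sup>2
       = (l2_norm m f)\<^sup>2 + 2 * l2_inner m f g + (l2_norm m g)\<^sup>2"
  using assms
  by (simp add: l2_norm_power2 l2_inner_add_left l2_inner_add_right l2_add l2_inner_commute)

lemma l2_norm_scale: "l2_norm m (\<lambda>x. c * f x) = \<bar>c\<bar> * l2_norm m f"
  by (simp add: l2_norm_def l2_inner_scale_left l2_inner_scale_right real_sqrt_mult
      flip: mult.assoc)

lemma l2_norm_minus_commute: "l2_norm m (\<lambda>x. f x - g x) = l2_norm m (\<lambda>x. g x - f x)"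
  using l2_norm_scale[of "-1" "\<lambda>x. f x - g x"] by simp

lemma sum_le_l2_norm:
  assumes "f \<in> l2 m" "finite A"
  shows "(\<Sum>x\<in>A. (f x)\<^sup>2 * m x) \<le> (l2_norm m f)\<^sup>2"
proof -
  have "(l2_norm m f)\<^sup>2 = (\<Sum>\<^sub>\<infinity>x. (f x)\<^sup>2 * m x)"
    unfolding l2_norm_power2 l2_inner_def by (simp add: power2_eq_square)
  also have "(\<Sum>x\<in>A. (f x)\<^sup>2 * m x) \<le> \<dots>"
    using assms weight_pos by (intro finite_sum_le_infsum) (auto simp: l2_def less_imp_le)
  finally show ?thesis .
qed

text \<open>A single term of the series is at most the whole. Since \<open>m x > 0\<close>, point
  evaluations are therefore continuous, so norm convergence implies pointwise convergence.\<close>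

lemma point_le_l2_norm:
  assumes "f \<in> l2 m"
  shows "\<bar>f x\<bar> * sqrt (m x) \<le> l2_norm m f"
proof -
  have "(\<bar>f x\<bar> * sqrt (m x))\<^sup>2 \<le> (l2_norm m f)\<^sup>2"
    using sum_le_l2_norm[OF assms, of "{x}"] weight_pos[of x] by (simp add: power_mult_distrib)
  then show ?thesis
    by (rule power2_le_imp_le) simp
qed

lemma l2_norm_eq_0D:
  assumes "f \<in> l2 m" "l2_norm m f = 0"
  shows "f x = 0"
  using point_le_l2_norm[OF assms(1), of x] assms(2) weight_pos[of x]
  by (simp add: mult_le_0_iff)

lemma l2_cauchy_schwarz:
  assumes "f \<in> l2 m" "g \<in> l2 m"
  shows "\<bar>l2_inner m f g\<bar> \<le> l2_norm m f * l2_norm m g"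
proof (cases "l2_norm m g = 0")
  case True
  then have "g = (\<lambda>x. 0)"
    using l2_norm_eq_0D[OF assms(2)] by auto
  then show ?thesis
    by simp
next
  case False
  then have pos: "l2_norm m g > 0"
    by (simp add: order_less_le)
  \<comment> \<open>This \<open>?t\<close> minimises the norm of \<open>f + t g\<close> over
    \<open>t\<close>; nonnegativity of the minimum is the inequality.\<close>
  let ?t = "- l2_inner m f g / (l2_norm m g)\<^sup>2"
  have "0 \<le> (l2_norm m (\<lambda>x. f x + ?t * g x))\<^sup>2"
    by simp
  also have "\<dots> = (l2_norm m f)\<^sup>2 + 2 * (?t * l2_inner m f g) + ?t\<^sup>2 * (l2_norm m g)\<^sup>2"
    using l2_norm_power2_add[OF assms(1) l2_scale[OF assms(2), of ?t]]
    by (simp only: l2_inner_scale_right l2_norm_scale power_mult_distrib power2_abs)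
  also have "\<dots> = (l2_norm m f)\<^sup>2 - (l2_inner m f g)\<^sup>2 / (l2_norm m g)\<^sup>2"
    using pos by (simp add: field_simps power2_eq_square)
  finally have "(l2_inner m f g)\<^sup>2 \<le> (l2_norm m f * l2_norm m g)\<^sup>2"
    using pos by (simp add: field_simps power_mult_distrib)
  then show ?thesis
    using power2_le_imp_le[of "\<bar>l2_inner m f g\<bar>"] by simp
qed

lemma l2_norm_triangle:
  assumes "f \<in> l2 m" "g \<in> l2 m"
  shows "l2_norm m (\<lambda>x. f x + g x) \<le> l2_norm m f + l2_norm m g"
proof (rule power2_le_imp_le)
  show "(l2_norm m (\<lambda>x. f x + g x))\<^sup>2 \<le> (l2_norm m f + l2_norm m g)\<^sup>2"
    using l2_cauchy_schwarz[OF assms]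
    by (simp add: l2_norm_power2_add[OF assms] power2_sum)
qed simp

lemma l2_norm_triangle_diff:
  assumes "f \<in> l2 m" "g \<in> l2 m" "h \<in> l2 m"
  shows "l2_norm m (\<lambda>x. f x - h x)
       \<le> l2_norm m (\<lambda>x. f x - g x) + l2_norm m (\<lambda>x. h x - g x)"
  using l2_norm_triangle[OF l2_diff[OF assms(1,2)] l2_diff[OF assms(2,3)]]
  by (simp add: l2_norm_minus_commute[of h g])

section \<open>Norm convergence and continuity of the inner product\<close>

lemma l2_tendsto_const: "l2_tendsto m (\<lambda>n. f) f"
  by (simp add: l2_tendsto_def l2_norm_def)

lemma l2_tendsto_pointwise:
  assumes "\<And>n. F n \<in> l2 m" "f \<in> l2 m" "l2_tendsto m F f"
  shows "(\<lambda>n. F n x) \<longlonglongrightarrow> f x"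
proof -
  have "(\<lambda>n. l2_norm m (\<lambda>x. F n x - f x) / sqrt (m x)) \<longlonglongrightarrow> 0"
    using assms(3) unfolding l2_tendsto_def by (rule tendsto_divide_zero)
  moreover have "norm (F n x - f x) \<le> l2_norm m (\<lambda>x. F n x - f x) / sqrt (m x)" for n
    using point_le_l2_norm[OF l2_diff[OF assms(1,2)], of n x] weight_pos[of x]
    by (simp add: field_simps)
  ultimately have "(\<lambda>n. F n x - f x) \<longlonglongrightarrow> 0"
    by (rule Lim_null_comparison[OF always_eventually[OF allI], rotated])
  then show ?thesis
    by (simp add: LIM_zero_iff)
qed

lemma l2_tendsto_inner:
  assumes "\<And>n. F n \<in> l2 m" "f \<in> l2 m" "l2_tendsto m F f"
    and "\<And>n. G n \<in> l2 m" "g \<in> l2 m" "l2_tendsto m G g"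
  shows "(\<lambda>n. l2_inner m (F n) (G n)) \<longlonglongrightarrow> l2_inner m f g"
proof -
  let ?u = "\<lambda>n. l2_norm m (\<lambda>x. F n x - f x)" and ?v = "\<lambda>n. l2_norm m (\<lambda>x. G n x - g x)"
  let ?B = "\<lambda>n. ?u n * ?v n + ?u n * l2_norm m g + l2_norm m f * ?v n"
  have u: "?u \<longlonglongrightarrow> 0" and v: "?v \<longlonglongrightarrow> 0"
    using assms(3,6) by (auto simp: l2_tendsto_def)
  have "?B \<longlonglongrightarrow> 0"
    by (rule tendsto_eq_intros u v refl | simp)+
  moreover have "norm (l2_inner m (F n) (G n) - l2_inner m f g) \<le> ?B n" for n
  proof -
    have dF: "(\<lambda>x. F n x - f x) \<in> l2 m" and dG: "(\<lambda>x. G n x - g x) \<in> l2 m"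
      using assms by auto
    \<comment> \<open>Bilinear expansion around the limits; Cauchy-Schwarz bounds the three terms by
      those of \<open>?B n\<close>.\<close>
    have "l2_inner m (F n) (G n) - l2_inner m f g =
        l2_inner m (\<lambda>x. F n x - f x) (\<lambda>x. G n x - g x) + l2_inner m (\<lambda>x. F n x - f x) g
        + l2_inner m f (\<lambda>x. G n x - g x)"
      using assms dF dG by (simp add: l2_inner_diff_left l2_inner_diff_right)
    then show ?thesis
      using l2_cauchy_schwarz[OF dF dG] l2_cauchy_schwarz[OF dF assms(5)]
        l2_cauchy_schwarz[OF assms(2) dG] by simp
  qed
  ultimately have "(\<lambda>n. l2_inner m (F n) (G n) - l2_inner m f g) \<longlonglongrightarrow> 0"
    by (rule Lim_null_comparison[OF always_eventually[OF allI], rotated])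
  then show ?thesis
    by (simp add: LIM_zero_iff)
qed

lemma l2_tendsto_add_const:
  assumes "l2_tendsto m F f"
  shows "l2_tendsto m (\<lambda>n x. F n x + h x) (\<lambda>x. f x + h x)"
  using assms by (simp add: l2_tendsto_def)

lemma l2_tendsto_norm_power2:
  assumes "\<And>n. F n \<in> l2 m" "f \<in> l2 m" "l2_tendsto m F f"
  shows "(\<lambda>n. (l2_norm m (F n))\<^sup>2) \<longlonglongrightarrow> (l2_norm m f)\<^sup>2"
  unfolding l2_norm_power2 by (intro l2_tendsto_inner assms)

section \<open>Completeness\<close>

definition l2_Cauchy :: "(nat \<Rightarrow> 'a \<Rightarrow> real) \<Rightarrow> bool" where
  "l2_Cauchy F \<longleftrightarrow>
     (\<forall>e>0. \<exists>N. \<forall>i\<ge>N. \<forall>j\<ge>N. l2_norm m (\<lambda>x. F i x - F j x) < e)"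

lemma l2_tendsto_imp_Cauchy:
  assumes "\<And>n. F n \<in> l2 m" "f \<in> l2 m" "l2_tendsto m F f"
  shows "l2_Cauchy F"
  unfolding l2_Cauchy_def
proof (intro allI impI)
  fix e :: real assume "e > 0"
  then have "e / 2 > 0" by simp
  then obtain N where N: "\<And>n. n \<ge> N \<Longrightarrow> l2_norm m (\<lambda>x. F n x - f x) < e / 2"
    using LIMSEQ_D[OF assms(3)[unfolded l2_tendsto_def], of "e / 2"] by auto
  have "l2_norm m (\<lambda>x. F i x - F j x) < e" if "i \<ge> N" "j \<ge> N" for i j
    using l2_norm_triangle_diff[OF assms(1)[of i] assms(2) assms(1)[of j]]
      N[OF that(1)] N[OF that(2)] by linarith
  then show "\<exists>N. \<forall>i\<ge>N. \<forall>j\<ge>N. l2_norm m (\<lambda>x. F i x - F j x) < e"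
    by blast
qed

text \<open>The candidate is the pointwise limit. The Cauchy estimate survives the limit on finite
  sets, uniformly in the set, and hence holds for the full series.\<close>

lemma l2_complete:
  assumes F: "\<And>n. F n \<in> l2 m" and "l2_Cauchy F"
  obtains f where "f \<in> l2 m" "l2_tendsto m F f"
proof -
  have "Cauchy (\<lambda>n. F n x)" for x
  proof (rule metric_CauchyI)
    fix e :: real assume "e > 0"
    then have "e * sqrt (m x) > 0" using weight_pos[of x] by simp
    then obtain N where
      N: "\<And>i j. i \<ge> N \<Longrightarrow> j \<ge> N \<Longrightarrow> l2_norm m (\<lambda>x. F i x - F j x) < e * sqrt (m x)"
      using assms(2) unfolding l2_Cauchy_def by blast
    have "dist (F i x) (F j x) < e" if "i \<ge> N" "j \<ge> N" for i j
    proof -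
      have "\<bar>F i x - F j x\<bar> * sqrt (m x) < e * sqrt (m x)"
        using point_le_l2_norm[OF l2_diff[OF F[of i] F[of j]], of x] N[OF that] by linarith
      then show ?thesis using weight_pos[of x] by (simp add: dist_real_def)
    qed
    then show "\<exists>N. \<forall>i\<ge>N. \<forall>j\<ge>N. dist (F i x) (F j x) < e" by blast
  qed
  then have "\<exists>l. (\<lambda>n. F n x) \<longlonglongrightarrow> l" for x
    by (simp add: Cauchy_convergent_iff convergent_def)
  then obtain f where f: "\<And>x. (\<lambda>n. F n x) \<longlonglongrightarrow> f x"
    by metis
  \<comment> \<open>Membership is proved along with the bound: outside \<open>l2 m\<close> the
    series in the norm diverges and \<open>infsum\<close> takes the default value 0, so the bound
    alone would say nothing.\<close>
  have key: "\<exists>N. \<forall>n\<ge>N. (\<lambda>x. F n x - f x) \<in> l2 m \<and> l2_norm m (\<lambda>x. F n x - f x) \<le> e"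
    if "e > 0" for e
  proof -
    obtain N where N: "\<And>i j. i \<ge> N \<Longrightarrow> j \<ge> N \<Longrightarrow> l2_norm m (\<lambda>x. F i x - F j x) < e"
      using assms(2) \<open>e > 0\<close> unfolding l2_Cauchy_def by blast
    \<comment> \<open>Over a finite \<open>A\<close> the limit
      \<open>j \<rightarrow> \<infinity>\<close> may be taken term by term.\<close>
    have bound: "(\<Sum>x\<in>A. (F n x - f x)\<^sup>2 * m x) \<le> e\<^sup>2" if "finite A" "n \<ge> N" for A n
    proof (rule tendsto_upperbound)
      show "(\<lambda>j. \<Sum>x\<in>A. (F n x - F j x)\<^sup>2 * m x) \<longlonglongrightarrow> (\<Sum>x\<in>A. (F n x - f x)\<^sup>2 * m x)"
        by (intro tendsto_intros f)
      show "\<forall>\<^sub>F j in sequentially. (\<Sum>x\<in>A. (F n x - F j x)\<^sup>2 * m x) \<le> e\<^sup>2"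
      proof (rule eventually_sequentiallyI[of N])
        fix j assume "j \<ge> N"
        have "(\<Sum>x\<in>A. (F n x - F j x)\<^sup>2 * m x) \<le> (l2_norm m (\<lambda>x. F n x - F j x))\<^sup>2"
          using \<open>finite A\<close> F by (intro sum_le_l2_norm) auto
        also have "\<dots> \<le> e\<^sup>2"
          using N[OF \<open>n \<ge> N\<close> \<open>j \<ge> N\<close>] by (intro power_mono) auto
        finally show "(\<Sum>x\<in>A. (F n x - F j x)\<^sup>2 * m x) \<le> e\<^sup>2" .
      qed
    qed simp
    have "(\<lambda>x. F n x - f x) \<in> l2 m \<and> l2_norm m (\<lambda>x. F n x - f x) \<le> e" if "n \<ge> N" for n
    proof
      show in_l2: "(\<lambda>x. F n x - f x) \<in> l2 m"
        unfolding l2_def mem_Collect_eq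
      proof (rule nonneg_bdd_above_summable_on)
        show "bdd_above (sum (\<lambda>x. (F n x - f x)\<^sup>2 * m x) ` {A. A \<subseteq> UNIV \<and> finite A})"
          using bound \<open>n \<ge> N\<close> by (intro bdd_aboveI[of _ "e\<^sup>2"]) auto
      qed (simp add: weight_pos less_imp_le)
      have "(l2_norm m (\<lambda>x. F n x - f x))\<^sup>2 \<le> e\<^sup>2"
        unfolding l2_norm_power2 l2_inner_def
        using in_l2 bound \<open>n \<ge> N\<close>
        by (intro infsum_le_finite_sums) (auto simp: l2_def power2_eq_square)
      then show "l2_norm m (\<lambda>x. F n x - f x) \<le> e"
        using \<open>e > 0\<close> by (rule power2_le_imp_le[OF _ less_imp_le])
    qed
    then show ?thesis by blast
  qed
  obtain n where "(\<lambda>x. F n x - f x) \<in> l2 m"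
    using key[of 1] by auto
  then have "f \<in> l2 m"
    using l2_diff[OF F[of n]] by fastforce
  moreover have "l2_tendsto m F f"
    unfolding l2_tendsto_def
  proof (rule LIMSEQ_I)
    fix r :: real assume "r > 0"
    then obtain N where "\<forall>n\<ge>N. l2_norm m (\<lambda>x. F n x - f x) \<le> r / 2"
      using key[of "r / 2"] by auto
    then have "\<forall>n\<ge>N. norm (l2_norm m (\<lambda>x. F n x - f x) - 0) < r"
      using \<open>r > 0\<close> by (auto intro: le_less_trans)
    then show "\<exists>N. \<forall>n\<ge>N. norm (l2_norm m (\<lambda>x. F n x - f x) - 0) < r" ..
  qed
  ultimately show ?thesis by (rule that)
qed

section \<open>Density of finitely supported functions and of subspaces\<close>

lemma finitely_supported_dense:
  assumes "f \<in> l2 m"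
  shows "\<exists>F. (\<forall>n. F n \<in> finitely_supported) \<and> l2_tendsto m F f"
proof -
  have "\<exists>g\<in>finitely_supported. l2_norm m (\<lambda>x. g x - f x) < inverse (real (Suc n))" for n
  proof -
    let ?e = "(inverse (real (Suc n)))\<^sup>2" and ?q = "\<lambda>x. (f x)\<^sup>2 * m x"
    have q: "?q summable_on UNIV" using assms by (simp add: l2_def)
    have "?e > 0" by simp
    then obtain A where A: "finite A" "dist (sum ?q A) (infsum ?q UNIV) < ?e"
      using tendstoD[OF infsum_tendsto[OF q]] unfolding eventually_finite_subsets_at_top by blast
    \<comment> \<open>Truncation of \<open>f\<close> to \<open>A\<close>: the squared error is the
      tail of the series outside \<open>A\<close>, which is why the tolerance \<open>?e\<close> is a
      square.\<close>
    let ?g = "\<lambda>x. if x \<in> A then f x else 0"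
    have fs: "?g \<in> finitely_supported"
      using A(1) by (auto simp: finitely_supported_def)
    have "(l2_norm m (\<lambda>x. ?g x - f x))\<^sup>2 = infsum ?q (UNIV - A)"
      unfolding l2_norm_power2 l2_inner_def
      by (rule infsum_cong_neutral) (auto simp: power2_eq_square)
    also have "\<dots> = infsum ?q UNIV - infsum ?q A"
      using q A(1) by (intro infsum_Diff) auto
    also have "\<dots> < ?e"
      using A by (simp add: dist_real_def)
    finally have "l2_norm m (\<lambda>x. ?g x - f x) < inverse (real (Suc n))"
      by (rule power2_less_imp_less) simp
    then show ?thesis using fs by (intro bexI[of _ ?g])
  qed
  then obtain F where F: "\<And>n. F n \<in> finitely_supported"
    "\<And>n. l2_norm m (\<lambda>x. F n x - f x) < inverse (real (Suc n))" by metis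
  have "l2_tendsto m F f"
    unfolding l2_tendsto_def
    using F(2) by (intro Lim_null_comparison[OF always_eventually[OF allI] LIMSEQ_inverse_real_of_nat])
      (simp add: less_imp_le)
  then show ?thesis using F(1) by blast
qed

text \<open>A sequence in \<open>V\<close> minimising the distance to \<open>h\<close> is Cauchy by the parallelogram law, and
  \<open>h\<close> minus its limit is orthogonal to \<open>V\<close>.\<close>

lemma dense_if_orthogonal_trivial:
  assumes V: "V \<subseteq> l2 m" "V \<noteq> {}"
    and add: "\<And>u v. u \<in> V \<Longrightarrow> v \<in> V \<Longrightarrow> (\<lambda>x. u x + v x) \<in> V"
    and scale: "\<And>c u. u \<in> V \<Longrightarrow> (\<lambda>x. c * u x) \<in> V"
    and orth: "\<And>g. g \<in> l2 m \<Longrightarrow> (\<And>v. v \<in> V \<Longrightarrow> l2_inner m v g = 0) \<Longrightarrow> g = (\<lambda>x. 0)"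
    and h: "h \<in> l2 m"
  shows "\<exists>K. (\<forall>n. K n \<in> V) \<and> l2_tendsto m K h"
proof -
  define D where "D v = (l2_norm m (\<lambda>x. v x - h x))\<^sup>2" for v
  define d where "d = Inf (D ` V)"
  have bdd: "bdd_below (D ` V)"
    by (intro bdd_belowI[of _ 0]) (auto simp: D_def)
  have d_le: "d \<le> D v" if "v \<in> V" for v
    unfolding d_def using that bdd by (intro cINF_lower)
  have "\<exists>v\<in>V. D v < d + inverse (real (Suc n))" for n
  proof -
    have "Inf (D ` V) < d + inverse (real (Suc n))" by (simp add: d_def)
    then show ?thesis using cInf_less_iff[of "D ` V"] V(2) bdd by auto
  qed
  then obtain K where K: "\<And>n. K n \<in> V" "\<And>n. D (K n) < d + inverse (real (Suc n))"
    by metis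
  have Kl2: "K n \<in> l2 m" for n using K(1) V(1) by auto
  have parallelogram: "(l2_norm m (\<lambda>x. K i x - K j x))\<^sup>2
      \<le> 2 * inverse (real (Suc i)) + 2 * inverse (real (Suc j))" for i j
  proof -
    let ?u = "\<lambda>x. K i x - h x" and ?v = "\<lambda>x. K j x - h x"
      and ?w = "\<lambda>x. (1/2) * (K i x + K j x)"
    have u: "?u \<in> l2 m" and v: "?v \<in> l2 m" using Kl2 h by auto
    \<comment> \<open>The midpoint stays in \<open>V\<close>, so its squared distance to
      \<open>h\<close> is at least the infimum \<open>d\<close>. In the parallelogram identity this
      leaves only the excesses of \<open>D (K i)\<close> and \<open>D (K j)\<close> over
      \<open>d\<close>, each doubled.\<close>
    have "d \<le> D ?w" by (intro d_le scale add K(1))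
    moreover have "4 * D ?w = (l2_norm m (\<lambda>x. ?u x + ?v x))\<^sup>2"
    proof -
      have "(\<lambda>x. ?u x + ?v x) = (\<lambda>x. 2 * (?w x - h x))" by (auto simp: algebra_simps)
      then show ?thesis
        unfolding D_def by (simp only: l2_norm_scale power_mult_distrib) simp
    qed
    moreover have "(l2_norm m (\<lambda>x. ?u x + ?v x))\<^sup>2
        = D (K i) + 2 * l2_inner m ?u ?v + D (K j)"
      unfolding D_def by (rule l2_norm_power2_add[OF u v])
    moreover have "(l2_norm m (\<lambda>x. K i x - K j x))\<^sup>2 = D (K i) - 2 * l2_inner m ?u ?v + D (K j)"
      using l2_norm_power2_add[OF u l2_scale[OF v, of "-1"]]
        l2_inner_scale_right[of ?u "-1" ?v] l2_norm_scale[of "-1" ?v]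
      by (simp add: D_def)
    ultimately show ?thesis using K(2)[of i] K(2)[of j] by linarith
  qed
  have "l2_Cauchy K"
    unfolding l2_Cauchy_def
  proof (intro allI impI)
    fix e :: real assume "e > 0"
    then obtain N where N: "inverse (real (Suc N)) < e\<^sup>2 / 4"
      using reals_Archimedean[of "e\<^sup>2 / 4"] by auto
    have inv: "inverse (real (Suc i)) < e\<^sup>2 / 4" if "i \<ge> N" for i
    proof -
      have "inverse (real (Suc i)) \<le> inverse (real (Suc N))"
        using that by (intro le_imp_inverse_le) auto
      then show ?thesis using N by linarith
    qed
    have "l2_norm m (\<lambda>x. K i x - K j x) < e" if "i \<ge> N" "j \<ge> N" for i j
    proof (rule power2_less_imp_less)
      show "(l2_norm m (\<lambda>x. K i x - K j x))\<^sup>2 < e\<^sup>2"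
        using parallelogram[of i j] inv[OF that(1)] inv[OF that(2)] by linarith
    qed (use \<open>e > 0\<close> in simp)
    then show "\<exists>N. \<forall>i\<ge>N. \<forall>j\<ge>N. l2_norm m (\<lambda>x. K i x - K j x) < e" by blast
  qed
  then obtain k where k: "k \<in> l2 m" "l2_tendsto m K k"
    using l2_complete[of K] Kl2 by blast
  let ?r = "\<lambda>x. k x - h x"
  have r: "?r \<in> l2 m" using k h by auto
  have lim: "(\<lambda>n. (l2_norm m (\<lambda>x. K n x + g x))\<^sup>2) \<longlonglongrightarrow> (l2_norm m (\<lambda>x. k x + g x))\<^sup>2"
    if "g \<in> l2 m" for g
    using that Kl2 k by (intro l2_tendsto_norm_power2 l2_tendsto_add_const) auto
  have r_min: "(l2_norm m ?r)\<^sup>2 \<le> d"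
  proof (rule LIMSEQ_le)
    show "(\<lambda>n. D (K n)) \<longlonglongrightarrow> (l2_norm m ?r)\<^sup>2"
      using lim[OF l2_scale[OF h, of "-1"]] by (simp add: D_def)
    show "(\<lambda>n. d + inverse (real (Suc n))) \<longlonglongrightarrow> d"
      by (rule LIMSEQ_inverse_real_of_nat_add)
    show "\<exists>N. \<forall>n\<ge>N. D (K n) \<le> d + inverse (real (Suc n))"
      using K(2) by (auto intro: less_imp_le)
  qed
  have "l2_inner m v ?r = 0" if "v \<in> V" for v
  proof (rule quadratic_nonneg_imp_linear_zero)
    fix t :: real
    have v: "v \<in> l2 m" using that V(1) by auto
    \<comment> \<open>The limit \<open>k\<close> need not lie in \<open>V\<close>, so minimality is
      applied to \<open>K n + t v\<close>, which does, and then passed to the limit.\<close>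
    have "d \<le> (l2_norm m (\<lambda>x. ?r x + t * v x))\<^sup>2"
    proof (rule LIMSEQ_le_const)
      show "(\<lambda>n. D (\<lambda>x. K n x + t * v x)) \<longlonglongrightarrow> (l2_norm m (\<lambda>x. ?r x + t * v x))\<^sup>2"
        using lim[OF l2_diff[OF l2_scale[OF v, of t] h]]
        by (simp add: D_def algebra_simps)
      show "\<exists>N. \<forall>n\<ge>N. d \<le> D (\<lambda>x. K n x + t * v x)"
        using K(1) that add scale d_le by auto
    qed
    also have "\<dots> = (l2_norm m ?r)\<^sup>2 + 2 * (t * l2_inner m ?r v) + t\<^sup>2 * (l2_norm m v)\<^sup>2"
      using l2_norm_power2_add[OF r l2_scale[OF v, of t]]
      by (simp only: l2_inner_scale_right l2_norm_scale power_mult_distrib power2_abs)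
    finally show "0 \<le> 2 * t * l2_inner m v ?r + t\<^sup>2 * (l2_norm m v)\<^sup>2"
      using r_min by (simp add: l2_inner_commute)
  qed simp
  then have "?r = (\<lambda>x. 0)" using orth[OF r] by blast
  then have "k = h" by (simp add: fun_eq_iff)
  then show ?thesis using K(1) k(2) by blast
qed

section \<open>Symmetric operators\<close>

lemma op_closure_superset:
  assumes "T \<subseteq> l2 m \<times> l2 m"
  shows "T \<subseteq> op_closure m T"
  unfolding op_closure_def using assms l2_tendsto_const by fastforce

text \<open>The identity defining the adjoint is preserved under limits by continuity of the inner
  product. Self-adjointness of the closure can thus be tested by comparing the closure with the
  adjoint of \<open>T\<close> itself.\<close>

lemma op_adjoint_closure:
  assumes T: "T \<subseteq> l2 m \<times> l2 m"
  shows "op_adjoint m (op_closure m T) = op_adjoint m T"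
proof
  show "op_adjoint m (op_closure m T) \<subseteq> op_adjoint m T"
    using op_closure_superset[OF T] by (fastforce simp: op_adjoint_def)
  show "op_adjoint m T \<subseteq> op_adjoint m (op_closure m T)"
  proof clarify
    fix g h assume gh: "(g, h) \<in> op_adjoint m T"
    then have l2: "g \<in> l2 m" "h \<in> l2 m" by (auto simp: op_adjoint_def)
    have "l2_inner m k g = l2_inner m f h" if "(f, k) \<in> op_closure m T" for f k
    proof -
      from that obtain F K where FK: "\<And>n. (F n, K n) \<in> T" "l2_tendsto m F f" "l2_tendsto m K k"
        and fk: "f \<in> l2 m" "k \<in> l2 m" by (auto simp: op_closure_def)
      have FKl2: "F n \<in> l2 m" "K n \<in> l2 m" for n using FK(1)[of n] T by auto
      have "(\<lambda>n. l2_inner m (K n) g) \<longlonglongrightarrow> l2_inner m k g"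
        using FKl2 FK fk l2 by (intro l2_tendsto_inner l2_tendsto_const) auto
      moreover have "(\<lambda>n. l2_inner m (F n) h) \<longlonglongrightarrow> l2_inner m f h"
        using FKl2 FK fk l2 by (intro l2_tendsto_inner l2_tendsto_const) auto
      moreover have "l2_inner m (K n) g = l2_inner m (F n) h" for n
        using gh FK(1)[of n] by (auto simp: op_adjoint_def)
      ultimately show ?thesis
        using LIMSEQ_unique by simp
    qed
    then show "(g, h) \<in> op_adjoint m (op_closure m T)"
      using l2 by (auto simp: op_adjoint_def)
  qed
qed

text \<open>If the adjoint is injective then the range is dense; by strict positivity the range of the
  closure is closed, so the closure is surjective, and a surjective symmetric operator with
  injective adjoint coincides with its adjoint.\<close>

lemma strictly_positive_essentially_self_adjoint:
  assumes T: "T \<subseteq> l2 m \<times> l2 m" "T \<noteq> {}"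
    and dense: "densely_defined m T"
    and add: "\<And>f k g l. (f, k) \<in> T \<Longrightarrow> (g, l) \<in> T \<Longrightarrow> (\<lambda>x. f x + g x, \<lambda>x. k x + l x) \<in> T"
    and scale: "\<And>c f k. (f, k) \<in> T \<Longrightarrow> (\<lambda>x. c * f x, \<lambda>x. c * k x) \<in> T"
    and sym: "T \<subseteq> op_adjoint m T"
    and pos: "strictly_positive m T"
    and ker: "op_kernel (op_adjoint m T) \<subseteq> {\<lambda>x. 0}"
  shows "essentially_self_adjoint m T"
proof -
  obtain C where C: "C > 0" "\<And>f k. (f, k) \<in> T \<Longrightarrow> C * (l2_norm m f)\<^sup>2 \<le> l2_inner m k f"
    using pos by (auto simp: strictly_positive_def)
  \<comment> \<open>Strict positivity and Cauchy-Schwarz, with one factor \<open>l2_norm m f\<close>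
    cancelled: \<open>T\<close> is bounded below.\<close>
  have norm_le: "C * l2_norm m f \<le> l2_norm m k" if "(f, k) \<in> T" for f k
  proof (cases "l2_norm m f = 0")
    case False
    have "C * l2_norm m f * l2_norm m f \<le> l2_norm m k * l2_norm m f"
      using C(2)[OF that] l2_cauchy_schwarz[of k f] that T(1)
      by (auto simp: power2_eq_square mult.assoc)
    then show ?thesis using False by (simp add: mult_le_cancel_right order_less_le)
  qed simp
  have diff: "(\<lambda>x. f x - g x, \<lambda>x. k x - l x) \<in> T" if "(f, k) \<in> T" "(g, l) \<in> T" for f g k l
    using add[OF that(1) scale[OF that(2), of "-1"]] by simp
  \<comment> \<open>The orthogonal complement of the range is the kernel of the adjoint.\<close>
  have kerD: "g = (\<lambda>x. 0)" if "g \<in> l2 m" "\<And>k. k \<in> Range T \<Longrightarrow> l2_inner m k g = 0" for g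
  proof -
    have "(g, \<lambda>x. 0) \<in> op_adjoint m T" using that by (auto simp: op_adjoint_def)
    then show ?thesis using ker by (auto simp: op_kernel_def)
  qed
  have surj: "\<exists>u. (u, h) \<in> op_closure m T" if h: "h \<in> l2 m" for h
  proof -
    have "\<exists>K. (\<forall>n. K n \<in> Range T) \<and> l2_tendsto m K h"
    proof (rule dense_if_orthogonal_trivial)
      show "Range T \<subseteq> l2 m" "Range T \<noteq> {}" using T by auto
      show "(\<lambda>x. u x + v x) \<in> Range T" if "u \<in> Range T" "v \<in> Range T" for u v
        using that add by (meson Range_iff)
      show "(\<lambda>x. c * u x) \<in> Range T" if "u \<in> Range T" for c u
        using that scale by (meson Range_iff)
    qed (use kerD h in auto)
    then obtain K where "\<forall>n. K n \<in> Range T" and K: "l2_tendsto m K h" by blast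
    then have "\<forall>n. \<exists>f. (f, K n) \<in> T" by blast
    then obtain F where FK: "\<And>n. (F n, K n) \<in> T" by metis
    have FKl2: "F n \<in> l2 m" "K n \<in> l2 m" for n using FK[of n] T by auto
    have "l2_Cauchy F"
      unfolding l2_Cauchy_def
    proof (intro allI impI)
      fix e :: real assume "e > 0"
      then have "C * e > 0" using C(1) by simp
      then obtain N where N: "\<And>i j. i \<ge> N \<Longrightarrow> j \<ge> N \<Longrightarrow> l2_norm m (\<lambda>x. K i x - K j x) < C * e"
        using l2_tendsto_imp_Cauchy[OF FKl2(2) h K] unfolding l2_Cauchy_def by blast
      have "l2_norm m (\<lambda>x. F i x - F j x) < e" if "i \<ge> N" "j \<ge> N" for i j
      proof -
        \<comment> \<open>Boundedness below, applied to differences, transfers the Cauchy property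
          from the images \<open>K n\<close> to the preimages \<open>F n\<close>.\<close>
        have "C * l2_norm m (\<lambda>x. F i x - F j x) < C * e"
          using norm_le[OF diff[OF FK FK]] N[OF that] by (rule le_less_trans)
        then show ?thesis using C(1) by simp
      qed
      then show "\<exists>N. \<forall>i\<ge>N. \<forall>j\<ge>N. l2_norm m (\<lambda>x. F i x - F j x) < e" by blast
    qed
    then obtain u where "u \<in> l2 m" "l2_tendsto m F u"
      using l2_complete[of F] FKl2 by blast
    then have "(u, h) \<in> op_closure m T" using h FK K by (auto simp: op_closure_def)
    then show ?thesis by blast
  qed
  \<comment> \<open>The closure inherits the symmetry relation with elements of \<open>T\<close> by
    passing to the limit in one argument.\<close>
  have closure_sym: "op_closure m T \<subseteq> op_adjoint m T"
  proof clarify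
    fix u h assume "(u, h) \<in> op_closure m T"
    then obtain F K where FK: "\<And>n. (F n, K n) \<in> T" "l2_tendsto m F u" "l2_tendsto m K h"
      and uh: "u \<in> l2 m" "h \<in> l2 m" by (auto simp: op_closure_def)
    have FKl2: "F n \<in> l2 m" "K n \<in> l2 m" for n using FK(1)[of n] T by auto
    have "l2_inner m k u = l2_inner m f h" if "(f, k) \<in> T" for f k
    proof -
      have fk: "f \<in> l2 m" "k \<in> l2 m" using that T(1) by auto
      have "(\<lambda>n. l2_inner m k (F n)) \<longlonglongrightarrow> l2_inner m k u"
        using FKl2 FK fk uh by (intro l2_tendsto_inner l2_tendsto_const) auto
      moreover have "(\<lambda>n. l2_inner m f (K n)) \<longlonglongrightarrow> l2_inner m f h"
        using FKl2 FK fk uh by (intro l2_tendsto_inner l2_tendsto_const) auto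
      moreover have "l2_inner m k (F n) = l2_inner m f (K n)" for n
        using that sym FK(1)[of n] by (auto simp: op_adjoint_def)
      ultimately show ?thesis
        using LIMSEQ_unique by simp
    qed
    then show "(u, h) \<in> op_adjoint m T" using uh by (auto simp: op_adjoint_def)
  qed
  have "op_adjoint m T \<subseteq> op_closure m T"
  proof clarify
    fix g h assume gh: "(g, h) \<in> op_adjoint m T"
    then have l2: "g \<in> l2 m" "h \<in> l2 m" by (auto simp: op_adjoint_def)
    obtain u where u: "(u, h) \<in> op_closure m T" using surj[OF l2(2)] ..
    then have u': "(u, h) \<in> op_adjoint m T" using closure_sym by blast
    then have ul2: "u \<in> l2 m" by (auto simp: op_adjoint_def)
    \<comment> \<open>Both \<open>g\<close> and \<open>u\<close> are sent to \<open>h\<close> by the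
      adjoint, so their difference is orthogonal to the range of \<open>T\<close>.\<close>
    have "(\<lambda>x. g x - u x) = (\<lambda>x. 0)"
    proof (rule kerD)
      show "(\<lambda>x. g x - u x) \<in> l2 m" using l2 ul2 by auto
      fix k assume "k \<in> Range T"
      then obtain f where "(f, k) \<in> T" by blast
      moreover from this have "k \<in> l2 m" using T(1) by auto
      ultimately show "l2_inner m k (\<lambda>x. g x - u x) = 0"
        using gh u' l2 ul2 by (fastforce simp: op_adjoint_def l2_inner_diff_right)
    qed
    then have "g = u" by (simp add: fun_eq_iff)
    then show "(g, h) \<in> op_closure m T" using u by simp
  qed
  moreover have "densely_defined m (op_closure m T)"
    using dense op_closure_superset[OF T(1)] unfolding densely_defined_def
    by (meson Domain_mono subsetD)
  ultimately show ?thesis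
    unfolding essentially_self_adjoint_def self_adjoint_def
    using op_adjoint_closure[OF T(1)] closure_sym by auto
qed

end

section \<open>The Laplacian on finitely supported functions\<close>

sublocale weighted_graph \<subseteq> positive_weight m
  using measure_pos by unfold_locales

context weighted_graph
begin

section \<open>The series defining the Laplacian\<close>

lemma laplacian_domain_summable:
  assumes "f \<in> laplacian_domain b"
  shows "(\<lambda>y. b x y * f y) summable_on UNIV"
proof -
  have "(\<lambda>y. norm (b x y * f y)) summable_on UNIV"
    using assms by (simp add: laplacian_domain_def abs_mult weight_nonneg)
  then show ?thesis
    by (rule Infinite_Sum.abs_summable_summable)
qed

text \<open>Splitting into degree and adjacency parts is legitimate because both series converge
  separately on the domain.\<close>

lemma laplacian_eq:
  assumes "f \<in> laplacian_domain b"
  shows "m x * laplacian m b f x = f x * (\<Sum>\<^sub>\<infinity>y. b x y) - (\<Sum>\<^sub>\<infinity>y. b x y * f y)"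
proof -
  have "(\<Sum>\<^sub>\<infinity>y. b x y * (f x - f y)) = (\<Sum>\<^sub>\<infinity>y. f x * b x y + - 1 * (b x y * f y))"
    by (intro infsum_cong) (simp add: algebra_simps)
  also have "\<dots> = (\<Sum>\<^sub>\<infinity>y. f x * b x y) + (\<Sum>\<^sub>\<infinity>y. - 1 * (b x y * f y))"
    using weight_summable laplacian_domain_summable[OF assms]
    by (intro infsum_add summable_on_cmult_right)
  also have "\<dots> = f x * (\<Sum>\<^sub>\<infinity>y. b x y) - (\<Sum>\<^sub>\<infinity>y. b x y * f y)"
    unfolding infsum_cmult_right' by simp
  finally show ?thesis
    using measure_pos[of x] by (simp add: laplacian_def)
qed

lemma finitely_supported_laplacian_domain:
  assumes "f \<in> finitely_supported"
  shows "f \<in> laplacian_domain b"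
  using assms unfolding laplacian_domain_def finitely_supported_def
  by (auto intro!: has_sum_imp_summable[OF has_sum_finite_neutralI[of "{x. f x \<noteq> 0}"]])

text \<open>The set \<open>A\<close> may exceed the support, a freedom that the energy estimate uses
  to include two given vertices.\<close>

lemma laplacian_finitely_supported:
  assumes "{y. f y \<noteq> 0} \<subseteq> A" "finite A"
  shows "m x * laplacian m b f x = f x * (\<Sum>\<^sub>\<infinity>y. b x y) - (\<Sum>y\<in>A. b x y * f y)"
proof -
  have "f \<in> finitely_supported"
    using assms finite_subset by (auto simp: finitely_supported_def)
  moreover have "(\<Sum>\<^sub>\<infinity>y. b x y * f y) = (\<Sum>\<^sub>\<infinity>y\<in>A. b x y * f y)"
    using assms(1) by (intro infsum_cong_neutral) auto
  ultimately show ?thesis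
    using assms(2) by (simp add: laplacian_eq finitely_supported_laplacian_domain)
qed

section \<open>Linearity, Green's formula and the energy estimate\<close>

lemma finitely_supported_add:
  assumes "f \<in> finitely_supported" "g \<in> finitely_supported"
  shows "(\<lambda>x. f x + g x) \<in> finitely_supported"
proof -
  have "{x. f x + g x \<noteq> 0} \<subseteq> {x. f x \<noteq> 0} \<union> {x. g x \<noteq> 0}" by auto
  then show ?thesis
    using assms finite_subset by (fastforce simp: finitely_supported_def)
qed

lemma finitely_supported_scale:
  assumes "f \<in> finitely_supported"
  shows "(\<lambda>x. c * f x) \<in> finitely_supported"
  using assms by (auto simp: finitely_supported_def elim: rev_finite_subset)

lemma laplacian_add:
  assumes "f \<in> laplacian_domain b" "g \<in> laplacian_domain b"
  shows "laplacian m b (\<lambda>x. f x + g x) = (\<lambda>x. laplacian m b f x + laplacian m b g x)"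
proof
  fix x
  have "(\<lambda>y. b x y * (h x - h y)) summable_on UNIV" if "h \<in> laplacian_domain b" for h
  proof -
    have "(\<lambda>y. h x * b x y + - 1 * (b x y * h y)) summable_on UNIV"
      using weight_summable laplacian_domain_summable[OF that]
      by (intro summable_on_add summable_on_cmult_right)
    then show ?thesis by (simp add: algebra_simps)
  qed
  from infsum_add[OF this[OF assms(1)] this[OF assms(2)]]
  have "(\<Sum>\<^sub>\<infinity>y. b x y * (f x + g x - (f y + g y)))
      = (\<Sum>\<^sub>\<infinity>y. b x y * (f x - f y)) + (\<Sum>\<^sub>\<infinity>y. b x y * (g x - g y))"
    by (simp add: algebra_simps)
  then show "laplacian m b (\<lambda>x. f x + g x) x = laplacian m b f x + laplacian m b g x"
    by (simp add: laplacian_def algebra_simps add_divide_distrib)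
qed

lemma laplacian_scale: "laplacian m b (\<lambda>x. c * f x) = (\<lambda>x. c * laplacian m b f x)"
proof
  fix x
  have "(\<Sum>\<^sub>\<infinity>y. b x y * (c * f x - c * f y)) = (\<Sum>\<^sub>\<infinity>y. c * (b x y * (f x - f y)))"
    by (intro infsum_cong) (simp add: algebra_simps)
  then show "laplacian m b (\<lambda>x. c * f x) x = c * laplacian m b f x"
    by (simp add: laplacian_def infsum_cmult_right')
qed

text \<open>Finite support of \<open>\<phi>\<close> makes the interchange of sums harmless, so
  \<open>f\<close> may be any function in the domain of the formal Laplacian, square-summable or
  not.\<close>

lemma green_formula:
  assumes "\<phi> \<in> finitely_supported" "f \<in> laplacian_domain b"
  shows "l2_inner m (laplacian m b \<phi>) f = l2_inner m \<phi> (laplacian m b f)"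
proof -
  define S where "S = {x. \<phi> x \<noteq> 0}"
  have S: "finite S" using assms(1) by (simp add: S_def finitely_supported_def)
  let ?deg = "\<lambda>x. \<Sum>\<^sub>\<infinity>y. b x y"
  have has1: "((\<lambda>x. \<phi> x * ?deg x * f x) has_sum (\<Sum>z\<in>S. \<phi> z * ?deg z * f z)) UNIV"
    by (rule has_sum_finite_neutralI[OF S]) (auto simp: S_def)
  \<comment> \<open>A finite sum of convergent series, one for each \<open>z\<close> in the support;
    convergence is exactly the domain condition on \<open>f\<close>.\<close>
  have has2: "((\<lambda>x. \<Sum>z\<in>S. \<phi> z * (b z x * f x)) has_sum
      (\<Sum>z\<in>S. \<phi> z * (\<Sum>\<^sub>\<infinity>x. b z x * f x))) UNIV"
    using S
    by induction (auto intro!: has_sum_add has_sum_cmult_right has_sum_infsum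
        laplacian_domain_summable assms(2))
  have "laplacian m b \<phi> x * f x * m x
      = \<phi> x * ?deg x * f x + - 1 * (\<Sum>z\<in>S. \<phi> z * (b z x * f x))" for x
  proof -
    have "laplacian m b \<phi> x * f x * m x = (m x * laplacian m b \<phi> x) * f x" by simp
    also have "\<dots> = (\<phi> x * ?deg x - (\<Sum>z\<in>S. b x z * \<phi> z)) * f x"
      using S by (subst laplacian_finitely_supported[of \<phi> S x]) (auto simp: S_def)
    \<comment> \<open>Symmetry of \<open>b\<close> turns \<open>b x z\<close> into
      \<open>b z x\<close>, so that summing over \<open>x\<close> produces the adjacency part of the
      Laplacian of \<open>f\<close> at \<open>z\<close>.\<close>
    also have "\<dots> = \<phi> x * ?deg x * f x + - 1 * (\<Sum>z\<in>S. \<phi> z * (b z x * f x))"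
      by (simp add: left_diff_distrib sum_distrib_right weight_sym[of x] mult.assoc mult.left_commute)
    finally show ?thesis .
  qed
  then have "l2_inner m (laplacian m b \<phi>) f
      = (\<Sum>\<^sub>\<infinity>x. \<phi> x * ?deg x * f x + - 1 * (\<Sum>z\<in>S. \<phi> z * (b z x * f x)))"
    by (simp only: l2_inner_def)
  also have "\<dots> = (\<Sum>z\<in>S. \<phi> z * ?deg z * f z) + - 1 * (\<Sum>z\<in>S. \<phi> z * (\<Sum>\<^sub>\<infinity>x. b z x * f x))"
    by (intro infsumI has_sum_add has1 has_sum_cmult_right has2)
  also have "\<dots> = (\<Sum>z\<in>S. \<phi> z * (m z * laplacian m b f z))"
    by (simp add: laplacian_eq[OF assms(2)] right_diff_distrib sum_subtractf mult_ac)
  also have "\<dots> = (\<Sum>\<^sub>\<infinity>z\<in>S. \<phi> z * laplacian m b f z * m z)"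
    using S by (simp add: mult_ac)
  also have "\<dots> = l2_inner m \<phi> (laplacian m b f)"
    unfolding l2_inner_def by (intro infsum_cong_neutral) (auto simp: S_def)
  finally show ?thesis .
qed

text \<open>One edge term is at most the whole energy. Summation over ordered pairs counts each edge
  twice, whence the factor 2.\<close>

lemma energy_bound:
  assumes "\<phi> \<in> finitely_supported"
  shows "b x y * (\<phi> x - \<phi> y)\<^sup>2 \<le> 2 * l2_inner m (laplacian m b \<phi>) \<phi>"
proof -
  \<comment> \<open>Adding \<open>x\<close> and \<open>y\<close> makes their edge occur in the
    double sum even where \<open>\<phi>\<close> vanishes.\<close>
  define A where "A = {z. \<phi> z \<noteq> 0} \<union> {x, y}"
  have A: "finite A" using assms by (simp add: A_def finitely_supported_def)
  let ?e = "\<lambda>u v. b u v * (\<phi> u - \<phi> v)\<^sup>2"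
  have "?e x y \<le> (\<Sum>v\<in>A. ?e x v)"
    using A weight_nonneg by (intro member_le_sum) (auto simp: A_def)
  also have "\<dots> \<le> (\<Sum>u\<in>A. \<Sum>v\<in>A. ?e u v)"
    using A weight_nonneg
    by (intro member_le_sum[where f = "\<lambda>u. \<Sum>v\<in>A. ?e u v"]) (auto simp: A_def intro!: sum_nonneg)
  also have "\<dots> = 2 * (\<Sum>u\<in>A. \<Sum>v\<in>A. b u v * (\<phi> u * (\<phi> u - \<phi> v)))"
  proof -
    \<comment> \<open>The square splits as \<open>\<phi> u * (\<phi> u - \<phi> v) + \<phi> v *
      (\<phi> v - \<phi> u)\<close>; the two halves agree after swapping \<open>u\<close> and
      \<open>v\<close>.\<close>
    have "(\<Sum>u\<in>A. \<Sum>v\<in>A. ?e u v)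
        = (\<Sum>u\<in>A. \<Sum>v\<in>A. b u v * (\<phi> u * (\<phi> u - \<phi> v)))
        + (\<Sum>u\<in>A. \<Sum>v\<in>A. b u v * (\<phi> v * (\<phi> v - \<phi> u)))"
      by (simp add: power2_eq_square algebra_simps flip: sum.distrib)
    also have "(\<Sum>u\<in>A. \<Sum>v\<in>A. b u v * (\<phi> v * (\<phi> v - \<phi> u)))
        = (\<Sum>u\<in>A. \<Sum>v\<in>A. b u v * (\<phi> u * (\<phi> u - \<phi> v)))"
      by (subst sum.swap) (simp add: weight_sym)
    finally show ?thesis by simp
  qed
  also have "(\<Sum>u\<in>A. \<Sum>v\<in>A. b u v * (\<phi> u * (\<phi> u - \<phi> v)))
      \<le> (\<Sum>u\<in>A. laplacian m b \<phi> u * \<phi> u * m u)"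
  proof (rule sum_mono)
    fix u assume "u \<in> A"
    \<comment> \<open>Only an inequality results: the edges from \<open>u\<close> to vertices
      outside \<open>A\<close> are dropped.\<close>
    have "(\<Sum>v\<in>A. b u v) \<le> (\<Sum>\<^sub>\<infinity>v. b u v)"
      using A weight_nonneg weight_summable by (intro finite_sum_le_infsum) auto
    then have "\<phi> u * \<phi> u * (\<Sum>v\<in>A. b u v) \<le> \<phi> u * \<phi> u * (\<Sum>\<^sub>\<infinity>v. b u v)"
      by (intro mult_left_mono) auto
    moreover have "laplacian m b \<phi> u * \<phi> u * m u
        = \<phi> u * (\<phi> u * (\<Sum>\<^sub>\<infinity>v. b u v) - (\<Sum>v\<in>A. b u v * \<phi> v))"
      using laplacian_finitely_supported[of \<phi> A u] A by (simp add: A_def subset_eq mult_ac)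
    moreover have "(\<Sum>v\<in>A. b u v * (\<phi> u * (\<phi> u - \<phi> v)))
        = \<phi> u * \<phi> u * (\<Sum>v\<in>A. b u v) - \<phi> u * (\<Sum>v\<in>A. b u v * \<phi> v)"
      by (simp add: sum_distrib_left algebra_simps flip: sum_subtractf)
    ultimately show "(\<Sum>v\<in>A. b u v * (\<phi> u * (\<phi> u - \<phi> v))) \<le> laplacian m b \<phi> u * \<phi> u * m u"
      by (simp add: right_diff_distrib mult.assoc)
  qed
  also have "(\<Sum>u\<in>A. laplacian m b \<phi> u * \<phi> u * m u) = l2_inner m (laplacian m b \<phi>) \<phi>"
  proof -
    have "l2_inner m (laplacian m b \<phi>) \<phi> = (\<Sum>\<^sub>\<infinity>u\<in>A. laplacian m b \<phi> u * \<phi> u * m u)"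
      unfolding l2_inner_def by (intro infsum_cong_neutral) (auto simp: A_def)
    then show ?thesis using A by simp
  qed
  finally show ?thesis by simp
qed

section \<open>Constant functions and kernels\<close>

lemma connected_graph_constant_on:
  assumes "connected_graph b" and "\<And>x y. b x y > 0 \<Longrightarrow> f x = f y"
  shows "f constant_on UNIV"
proof -
  have "f x = f y" if "(adjacent b)\<^sup>*\<^sup>* x y" for x y
    using that by induction (auto simp: adjacent_def assms(2))
  then show ?thesis
    using assms(1) unfolding connected_graph_def constant_on_def by blast
qed

text \<open>The energy bound is available for the approximants. It passes to \<open>f\<close> by
  pointwise convergence on the left and continuity of the inner product on the right, where the
  limit is 0.\<close>

lemma closure_kernel_constant:
  assumes "connected_graph b" "L_c m b \<subseteq> l2 m \<times> l2 m" "(f, \<lambda>x. 0) \<in> op_closure m (L_c m b)"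
  shows "f constant_on UNIV"
proof (rule connected_graph_constant_on[OF assms(1)])
  fix x y assume xy: "b x y > 0"
  from assms(3) obtain F G where FG: "\<And>n. (F n, G n) \<in> L_c m b"
    "l2_tendsto m F f" "l2_tendsto m G (\<lambda>x. 0)" and f: "f \<in> l2 m"
    by (auto simp: op_closure_def)
  have l2: "F n \<in> l2 m" "G n \<in> l2 m" for n using FG(1)[of n] assms(2) by auto
  have "b x y * (f x - f y)\<^sup>2 \<le> 2 * l2_inner m (\<lambda>x. 0) f"
  proof (rule LIMSEQ_le)
    show "(\<lambda>n. b x y * (F n x - F n y)\<^sup>2) \<longlonglongrightarrow> b x y * (f x - f y)\<^sup>2"
      by (intro tendsto_intros l2_tendsto_pointwise l2 f FG)
    show "(\<lambda>n. 2 * l2_inner m (G n) (F n)) \<longlonglongrightarrow> 2 * l2_inner m (\<lambda>x. 0) f"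
      by (intro tendsto_intros l2_tendsto_inner l2 f FG l2_zero)
    show "\<exists>N. \<forall>n\<ge>N. b x y * (F n x - F n y)\<^sup>2 \<le> 2 * l2_inner m (G n) (F n)"
      using FG(1) energy_bound by (fastforce simp: L_c_def)
  qed
  then have "b x y * (f x - f y)\<^sup>2 \<le> 0" by (simp add: l2_inner_commute)
  then show "f x = f y" using xy by (simp add: mult_le_0_iff)
qed

text \<open>Green's formula with vanishing right-hand side; it carries the Liouville property from
  the adjoint kernel to harmonic functions.\<close>

lemma harmonic_in_adjoint_kernel:
  assumes "harmonic m b f" "f \<in> l2 m"
  shows "f \<in> op_kernel (op_adjoint m (L_c m b))"
proof -
  have "laplacian m b f = (\<lambda>x. 0)" using assms(1) by (auto simp: harmonic_def)
  then show ?thesis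
    using assms green_formula[of _ f]
    by (auto simp: op_kernel_def op_adjoint_def L_c_def harmonic_def)
qed

text \<open>A nonzero constant in \<open>l2 m\<close> would make \<open>m\<close> summable and the
  total measure finite.\<close>

lemma constant_l2_eq_0:
  assumes "vertex_measure m UNIV = \<infinity>" "f constant_on UNIV" "f \<in> l2 m"
  shows "f = (\<lambda>x. 0)"
proof -
  obtain c where c: "f = (\<lambda>x. c)" using assms(2) by (auto simp: constant_on_def fun_eq_iff)
  have "c = 0"
  proof (rule ccontr)
    assume "c \<noteq> 0"
    have "(\<lambda>x. c\<^sup>2 * m x) summable_on UNIV" using assms(3) c by (simp add: l2_def)
    then have "m summable_on UNIV"
      using \<open>c \<noteq> 0\<close> by (simp add: summable_on_cmult_right')
    \<comment> \<open>For nonnegative summable terms the real and the extended sum agree, both being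
      suprema of finite sums.\<close>
    then have "vertex_measure m UNIV = ennreal (infsum m UNIV)"
      unfolding vertex_measure_def
      using measure_pos
      by (simp add: infsum_nonneg_is_SUPREMUM_ennreal nonneg_infsum_complete less_imp_le)
    then show False using assms(1) by simp
  qed
  then show ?thesis using c by simp
qed

end

theorem corollary2:
  fixes m :: "'a \<Rightarrow> real" and b :: "'a \<Rightarrow> 'a \<Rightarrow> real"
  assumes "weighted_graph m b"
    and "connected_graph b"
    and "laplacian m b ` finitely_supported \<subseteq> l2 m"
  shows "(essentially_self_adjoint m (L_c m b) \<longrightarrow>
            l2_Liouville m (L_c m b) \<and>
            (\<forall>f. harmonic m b f \<and> f \<in> l2 m \<longrightarrow> f constant_on UNIV))
       \<and> (l2_Liouville m (L_c m b) \<and> strictly_positive m (L_c m b) \<and>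
            vertex_measure m UNIV = \<infinity> \<longrightarrow>
            essentially_self_adjoint m (L_c m b))"
proof -
  interpret weighted_graph m b by fact
  have T: "L_c m b \<subseteq> l2 m \<times> l2 m"
    using assms(3) finitely_supported_l2 by (auto simp: L_c_def)
  have Liouville: "l2_Liouville m (L_c m b)" if "essentially_self_adjoint m (L_c m b)"
  proof -
    \<comment> \<open>The closure equals its own adjoint, which is also the adjoint of
      \<open>L_c m b\<close>; kernel elements thus become accessible by finitely supported
      approximation.\<close>
    have "op_adjoint m (L_c m b) = op_closure m (L_c m b)"
      using that op_adjoint_closure[OF T]
      by (simp add: essentially_self_adjoint_def self_adjoint_def)
    then show ?thesis
      using closure_kernel_constant[OF assms(2) T] by (simp add: l2_Liouville_def op_kernel_def)
  qed
  have "essentially_self_adjoint m (L_c m b)"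
    if "l2_Liouville m (L_c m b)" "strictly_positive m (L_c m b)"
      "vertex_measure m UNIV = \<infinity>"
  proof (rule strictly_positive_essentially_self_adjoint[OF T])
    show "L_c m b \<noteq> {}"
      by (auto simp: L_c_def finitely_supported_def intro!: exI[of _ "\<lambda>x. 0"])
    show "densely_defined m (L_c m b)"
      using finitely_supported_dense by (fastforce simp: densely_defined_def L_c_def Domain_iff)
    show "(\<lambda>x. f x + g x, \<lambda>x. k x + l x) \<in> L_c m b"
      if "(f, k) \<in> L_c m b" "(g, l) \<in> L_c m b" for f k g l
      using that by (auto simp: L_c_def laplacian_add finitely_supported_add
          finitely_supported_laplacian_domain)
    show "(\<lambda>x. c * f x, \<lambda>x. c * k x) \<in> L_c m b" if "(f, k) \<in> L_c m b" for c f k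
      using that by (auto simp: L_c_def laplacian_scale finitely_supported_scale)
    show "L_c m b \<subseteq> op_adjoint m (L_c m b)"
      using T green_formula finitely_supported_laplacian_domain
      by (auto simp: op_adjoint_def L_c_def)
    \<comment> \<open>Here the Liouville property and infinite measure combine: kernel elements are
      constant and square-summable, hence zero.\<close>
    show "op_kernel (op_adjoint m (L_c m b)) \<subseteq> {\<lambda>x. 0}"
    proof
      fix f assume f: "f \<in> op_kernel (op_adjoint m (L_c m b))"
      then have "f \<in> l2 m" by (simp add: op_kernel_def op_adjoint_def)
      moreover have "f constant_on UNIV" using f that(1) by (simp add: l2_Liouville_def)
      ultimately show "f \<in> {\<lambda>x. 0}" using constant_l2_eq_0[OF that(3)] by simp
    qed
  qed (rule that(2))
  then show ?thesis
    using Liouville harmonic_in_adjoint_kernel unfolding l2_Liouville_def by blast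
qed

end
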